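(* Let $G$ be a connected graph on $n\ge 2$ vertices and $X$ a metric space with $|X|\ge 2$. Then $\lambda(G,X)\le \frac{n}{n-1}$.
   Context: All graphs are finite and simple. For a graph $G$, $d_v$ denotes the degree of $v$, $u\sim v$ means adjacency, and $\mathrm{vol}(G)=\sum_v d_v$. For a metric space $(X,d)$ and $f:V(G)\to X$ set $R_f(G,X)=\frac{\mathrm{vol}(G)\sum_{u\sim v} d(f(u),f(v))^2}{\sum_{u,v} d(f(u),f(v))^2 d_u d_v}$, where the numerator sum is over edges of $G$ and the denominator sum over unordered pairs of vertices; $\lambda(G,X)=\inf_f R_f(G,X)$ over all $f:V(G)\to X$ with nonzero denominator. *)

theory Defs
  imports "HOL-Analysis.Analysis" "Graph_Theory.Graph_Theory"
begin

text \<open>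
  Finite simple graphs are the \<^locale>\<open>pair_graph\<close>s of the AFP entry \<open>Graph_Theory\<close>: finite, loop-free
  digraphs without parallel arcs whose arc relation is symmetric. An undirected edge is thus a
  pair of opposite arcs; \<open>edges\<close> recovers it as a two-element set, and the degree of a vertex is
  its out-degree.
\<close>

abbreviation degree :: "'a pair_pre_digraph \<Rightarrow> 'a \<Rightarrow> nat" where
  "degree G v \<equiv> out_degree (with_proj G) v"

definition vol :: "'a pair_pre_digraph \<Rightarrow> nat" where
  "vol G = (\<Sum>v\<in>pverts G. degree G v)"

definition edges :: "'a pair_pre_digraph \<Rightarrow> 'a set set" where
  "edges G = {{u, v} | u v. (u, v) \<in> parcs G}"

definition vertex_pairs :: "'a pair_pre_digraph \<Rightarrow> 'a set set" where
  "vertex_pairs G = {{u, v} | u v. u \<in> pverts G \<and> v \<in> pverts G \<and> u \<noteq> v}"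

text \<open>
  The value of a symmetric \<open>h\<close> at an unordered pair. It is only meaningful for symmetric \<open>h\<close>,
  which holds below because a metric is symmetric.
\<close>

definition on_pair :: "('a \<Rightarrow> 'a \<Rightarrow> real) \<Rightarrow> 'a set \<Rightarrow> real" where
  "on_pair h e = (THE s. \<exists>u v. e = {u, v} \<and> s = h u v)"

lemma on_pair_eq:
  assumes "\<And>u v. h u v = h v u"
  shows "on_pair h {u, v} = h u v"
  unfolding on_pair_def
proof (rule the_equality)
  show "\<exists>a b. {u, v} = {a, b} \<and> h u v = h a b" by blast
next
  fix s assume "\<exists>a b. {u, v} = {a, b} \<and> s = h a b"
  then show "s = h u v" using assms by (auto simp: doubleton_eq_iff)
qed

definition energy :: "'a pair_pre_digraph \<Rightarrow> ('x \<Rightarrow> 'x \<Rightarrow> real) \<Rightarrow> ('a \<Rightarrow> 'x) \<Rightarrow> real" where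
  "energy G d f = (\<Sum>e\<in>edges G. on_pair (\<lambda>u v. (d (f u) (f v))\<^sup>2) e)"

definition dispersion :: "'a pair_pre_digraph \<Rightarrow> ('x \<Rightarrow> 'x \<Rightarrow> real) \<Rightarrow> ('a \<Rightarrow> 'x) \<Rightarrow> real" where
  "dispersion G d f =
    (\<Sum>p\<in>vertex_pairs G. on_pair (\<lambda>u v. (d (f u) (f v))\<^sup>2 * real (degree G u) * real (degree G v)) p)"

definition rayleigh :: "'a pair_pre_digraph \<Rightarrow> ('x \<Rightarrow> 'x \<Rightarrow> real) \<Rightarrow> ('a \<Rightarrow> 'x) \<Rightarrow> real" where
  "rayleigh G d f = real (vol G) * energy G d f / dispersion G d f"

text \<open>
  Maps from the vertex set to \<open>X\<close> are total functions sending \<open>pverts G\<close> into \<open>X\<close>; the Rayleigh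
  quotient does not depend on their values elsewhere. The quotients are nonnegative, and for a
  connected graph with at least two vertices and a space with at least two points the set of
  admissible maps is nonempty, so the real infimum is then a genuine one.
\<close>

definition spectral_gap :: "'a pair_pre_digraph \<Rightarrow> 'x set \<Rightarrow> ('x \<Rightarrow> 'x \<Rightarrow> real) \<Rightarrow> real" where
  "spectral_gap G X d =
    (INF f\<in>{f. f ` pverts G \<subseteq> X \<and> dispersion G d f \<noteq> 0}. rayleigh G d f)"

end

theory Submission
  imports Defs
begin

text \<open>
  Send a vertex \<open>v\<close> of minimum degree to a point \<open>x\<close> of \<open>X\<close> and every other vertex to a second
  point \<open>y\<close>. The squared distance cancels, and the Rayleigh quotient of this map equals
  \<open>vol G / (vol G - d\<^sub>v)\<close>. Since the minimum degree is at most the average degree \<open>vol G / n\<close>,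
  this is at most \<open>n / (n - 1)\<close>.
\<close>

text \<open>If \<open>h\<close> vanishes on all pairs of \<open>P\<close> outside the star of pairs
  {v, u} with u in \<open>N\<close>, only the star survives, and \<open>u\<close> \<mapsto> {v, u}
  is injective, so the sum can be indexed by the other endpoint. Both \<open>energy\<close> and
  \<open>dispersion\<close> of a map that is constant off \<open>v\<close> collapse this
  way.\<close>

lemma sum_on_pair_star:
  assumes sym: "\<And>u w. h u w = h w u"
    and "finite P" and "(\<lambda>u. {v, u}) ` N \<subseteq> P"
    and "\<And>e. e \<in> P \<Longrightarrow> e \<notin> (\<lambda>u. {v, u}) ` N \<Longrightarrow> on_pair h e = 0"
  shows "(\<Sum>e\<in>P. on_pair h e) = (\<Sum>u\<in>N. h v u)"
proof -
  have inj: "inj_on (\<lambda>u. {v, u}) N"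
    by (auto simp: inj_on_def doubleton_eq_iff)
  have "(\<Sum>e\<in>P. on_pair h e) = (\<Sum>e\<in>(\<lambda>u. {v, u}) ` N. on_pair h e)"
    using assms by (intro sum.mono_neutral_right) auto
  also have "\<dots> = (\<Sum>u\<in>N. h v u)"
    by (simp add: sum.reindex[OF inj] on_pair_eq[of h, OF sym])
  finally show ?thesis .
qed

lemma (in pair_fin_digraph) finite_edges: "finite (edges G)"
proof -
  have "edges G = (\<lambda>(u, v). {u, v}) ` parcs G"
    by (auto simp: edges_def image_iff)
  then show ?thesis using pair_finite_arcs by simp
qed

lemma (in pair_fin_digraph) finite_vertex_pairs: "finite (vertex_pairs G)"
proof -
  have "vertex_pairs G \<subseteq> Pow (pverts G)"
    by (auto simp: vertex_pairs_def)
  then show ?thesis using pair_finite_verts by (metis finite_Pow_iff finite_subset)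
qed

lemma degree_eq_card_neighbours: "degree G v = card {u. (v, u) \<in> parcs G}"
proof -
  have "out_arcs (with_proj G) v = Pair v ` {u. (v, u) \<in> parcs G}"
    by (auto simp: out_arcs_def)
  then show ?thesis
    unfolding out_degree_def by (simp add: card_image inj_on_def)
qed

text \<open>Symmetry of the arcs turns connectedness into reachability along directed walks. A walk
  from \<open>v\<close> to a different vertex has a first arc, and that arc leaves
  \<open>v\<close>.\<close>

lemma (in pair_graph) degree_pos:
  assumes "Digraph_Component.connected (with_proj G)"
    and "v \<in> pverts G" and "w \<in> pverts G" and "v \<noteq> w"
  shows "degree G v > 0"
proof -
  have "strongly_connected (with_proj G)"
    using assms(1) pair_sym_arcs by (rule symmetric_connected_imp_strongly_connected[rotated])
  then have "v \<rightarrow>\<^sup>*\<^bsub>with_proj G\<^esub> w"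
    using assms(2,3) by (auto simp: strongly_connected_def)
  then obtain u where "(v, u) \<in> parcs G"
    using \<open>v \<noteq> w\<close> by (cases rule: converse_reachable_cases) auto
  then have "out_arcs (with_proj G) v \<noteq> {}"
    by (auto simp: out_arcs_def)
  then show ?thesis
    unfolding out_degree_def using finite_out_arcs by (simp add: card_gt_0_iff)
qed

text \<open>Provides the lower bound that makes the real infimum in \<open>spectral_gap\<close> a
  lower bound of the quotients.\<close>

lemma rayleigh_nonneg:
  assumes "\<And>x y. d x y = d y x"
  shows "0 \<le> rayleigh G d f"
proof -
  have "0 \<le> energy G d f"
    unfolding energy_def
  proof (rule sum_nonneg)
    fix e assume "e \<in> edges G"
    then obtain u v where "e = {u, v}" by (auto simp: edges_def)
    then show "0 \<le> on_pair (\<lambda>u v. (d (f u) (f v))\<^sup>2) e"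
      by (simp add: on_pair_eq assms)
  qed
  moreover have "0 \<le> dispersion G d f"
    unfolding dispersion_def
  proof (rule sum_nonneg)
    fix e assume "e \<in> vertex_pairs G"
    then obtain u v where e: "e = {u, v}" by (auto simp: vertex_pairs_def)
    have "on_pair (\<lambda>u v. (d (f u) (f v))\<^sup>2 * real (degree G u) * real (degree G v)) e
        = (d (f u) (f v))\<^sup>2 * real (degree G u) * real (degree G v)"
      unfolding e by (rule on_pair_eq) (simp add: assms mult.commute mult.left_commute)
    then show "0 \<le> on_pair (\<lambda>u v. (d (f u) (f v))\<^sup>2 * real (degree G u) * real (degree G v)) e"
      by simp
  qed
  ultimately show ?thesis by (simp add: rayleigh_def)
qed

text \<open>An edge avoiding \<open>v\<close> has both ends sent to \<open>y\<close> and contributes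
  0; each edge at \<open>v\<close> contributes the same squared distance, and the degree counts
  these edges.\<close>

lemma (in pair_graph) energy_star:
  assumes sym: "\<And>x y. d x y = d y x" and "d y y = 0"
  shows "energy G d (\<lambda>u. if u = v then x else y) = real (degree G v) * (d x y)\<^sup>2"
proof -
  let ?f = "\<lambda>u. if u = v then x else y"
  let ?h = "\<lambda>u w. (d (?f u) (?f w))\<^sup>2"
  let ?N = "{u. (v, u) \<in> parcs G}"
  have arc_sym: "(w, u) \<in> parcs G" if "(u, w) \<in> parcs G" for u w
    using pair_sym_arcs that by (auto simp: symmetric_def dest: symD)
  have h_sym: "?h u w = ?h w u" for u w by (simp only: sym)
  have "energy G d ?f = (\<Sum>u\<in>?N. ?h v u)"
    unfolding energy_def
  proof (rule sum_on_pair_star[OF h_sym finite_edges])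
    show "(\<lambda>u. {v, u}) ` ?N \<subseteq> edges G" by (auto simp: edges_def)
  next
    fix e assume "e \<in> edges G" and e: "e \<notin> (\<lambda>u. {v, u}) ` ?N"
    then obtain u w where uw: "e = {u, w}" "(u, w) \<in> parcs G" by (auto simp: edges_def)
    \<comment> \<open>If \<open>w = v\<close>, reversing the arc shows that \<open>u\<close> is a
      neighbour of \<open>v\<close>, so \<open>e\<close> would lie in the star after all.\<close>
    with e have "u \<noteq> v" "w \<noteq> v" by (auto simp: insert_commute dest: arc_sym)
    have "on_pair ?h e = ?h u w"
      unfolding uw by (rule on_pair_eq[of ?h, OF h_sym])
    then show "on_pair ?h e = 0" using \<open>u \<noteq> v\<close> \<open>w \<noteq> v\<close> \<open>d y y = 0\<close> by simp
  qed
  also have "\<dots> = (\<Sum>u\<in>?N. (d x y)\<^sup>2)"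
  proof (rule sum.cong)
    fix u assume "u \<in> ?N"
    \<comment> \<open>Without loops a neighbour of \<open>v\<close> differs from \<open>v\<close>
      and is therefore sent to \<open>y\<close>.\<close>
    then have "u \<noteq> v" using pair_no_loops by fastforce
    then show "?h v u = (d x y)\<^sup>2" by simp
  qed simp
  also have "\<dots> = real (degree G v) * (d x y)\<^sup>2"
    by (simp add: degree_eq_card_neighbours)
  finally show ?thesis .
qed

text \<open>Only pairs containing \<open>v\<close> separate \<open>x\<close> from \<open>y\<close>.
  Their weights share the factor \<open>degree G v\<close>, and the degrees of the other vertices
  add up to the volume minus that degree.\<close>

lemma (in pair_graph) dispersion_star:
  assumes sym: "\<And>x y. d x y = d y x" and "d y y = 0" and v: "v \<in> pverts G"
  shows "dispersion G d (\<lambda>u. if u = v then x else y)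
    = real (degree G v) * (real (vol G) - real (degree G v)) * (d x y)\<^sup>2"
proof -
  let ?f = "\<lambda>u. if u = v then x else y"
  let ?h = "\<lambda>u w. (d (?f u) (?f w))\<^sup>2 * real (degree G u) * real (degree G w)"
  let ?N = "pverts G - {v}"
  have h_sym: "?h u w = ?h w u" for u w
    by (simp only: sym[of "?f u"] mult.assoc mult.commute[of "real (degree G u)"])
  have "dispersion G d ?f = (\<Sum>u\<in>?N. ?h v u)"
    unfolding dispersion_def
  proof (rule sum_on_pair_star[OF h_sym finite_vertex_pairs])
    show "(\<lambda>u. {v, u}) ` ?N \<subseteq> vertex_pairs G" using v by (auto simp: vertex_pairs_def)
  next
    fix e assume "e \<in> vertex_pairs G" and e: "e \<notin> (\<lambda>u. {v, u}) ` ?N"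
    then obtain u w where uw: "e = {u, w}" "u \<in> pverts G" "w \<in> pverts G" "u \<noteq> w"
      by (auto simp: vertex_pairs_def)
    with e have "u \<noteq> v" "w \<noteq> v" by (auto simp: insert_commute)
    have "on_pair ?h e = ?h u w"
      unfolding uw by (rule on_pair_eq[of ?h, OF h_sym])
    then show "on_pair ?h e = 0" using \<open>u \<noteq> v\<close> \<open>w \<noteq> v\<close> \<open>d y y = 0\<close> by simp
  qed
  also have "\<dots> = (\<Sum>u\<in>?N. (d x y)\<^sup>2 * real (degree G v) * real (degree G u))"
    by (rule sum.cong) auto
  also have "\<dots> = (d x y)\<^sup>2 * real (degree G v) * (\<Sum>u\<in>?N. real (degree G u))"
    by (simp add: sum_distrib_left)
  also have "(\<Sum>u\<in>?N. real (degree G u)) = real (vol G) - real (degree G v)"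
    using v pair_finite_verts by (simp add: vol_def sum_diff1)
  finally show ?thesis by (simp add: mult_ac)
qed

theorem theorem4p3:
  fixes G :: "'a pair_pre_digraph" and n :: nat
    and X :: "'x set" and d :: "'x \<Rightarrow> 'x \<Rightarrow> real"
  assumes "pair_graph G"
    and "Digraph_Component.connected (with_proj G)"
    and "card (pverts G) = n" and "n \<ge> 2"
    and "Metric_space X d"
    and "\<exists>x\<in>X. \<exists>y\<in>X. x \<noteq> y"
  shows "spectral_gap G X d \<le> real n / (real n - 1)"
proof -
  interpret pair_graph G by fact
  interpret M: Metric_space X d by fact
  obtain x y where xy: "x \<in> X" "y \<in> X" "x \<noteq> y" using assms(6) by blast
  have "pverts G \<noteq> {}" using assms(3,4) by auto
  then obtain v where v: "v \<in> pverts G"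
    and min: "\<And>u. u \<in> pverts G \<Longrightarrow> degree G v \<le> degree G u"
    using ex_min_if_finite[of "degree G ` pverts G"] pair_finite_verts
    by (auto simp: not_less)
  have "\<not> pverts G \<subseteq> {v}"
    using assms(3,4) card_mono[of "{v}" "pverts G"] by auto
  then obtain w where w: "w \<in> pverts G" "v \<noteq> w" by blast
  have deg: "degree G v > 0" by (rule degree_pos[OF assms(2) v w])
  \<comment> \<open>Each of the \<open>n\<close> summands of the volume is at least the minimum
    degree.\<close>
  have "n * degree G v \<le> vol G"
    unfolding vol_def assms(3)[symmetric] using sum_bounded_below[OF min, of "pverts G"] by simp
  then have le: "real n * real (degree G v) \<le> real (vol G)"
    by (metis of_nat_le_iff of_nat_mult)
  \<comment> \<open>Since \<open>n \<ge> 2\<close>, the volume is at least twice the positive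
    minimum degree, so it strictly exceeds it. This makes the dispersion of the test map
    nonzero.\<close>
  have "2 * real (degree G v) \<le> real n * real (degree G v)"
    using assms(4) by (intro mult_right_mono) auto
  with le deg have gap: "real (vol G) - real (degree G v) > 0" by linarith
  let ?f = "\<lambda>u. if u = v then x else y"
  have D: "(d x y)\<^sup>2 > 0" using xy by simp
  have dyy: "d y y = 0" using xy by simp
  note en = energy_star[of d y v x, OF M.commute dyy]
  note disp = dispersion_star[of d y v x, OF M.commute dyy v]
  have "dispersion G d ?f \<noteq> 0" unfolding disp using deg gap D by simp
  moreover have "?f ` pverts G \<subseteq> X" using xy by auto
  moreover have "bdd_below (rayleigh G d ` {f. f ` pverts G \<subseteq> X \<and> dispersion G d f \<noteq> 0})"
    by (rule bdd_belowI[of _ 0]) (auto intro: rayleigh_nonneg M.commute)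
  ultimately have "spectral_gap G X d \<le> rayleigh G d ?f"
    unfolding spectral_gap_def by (intro cINF_lower) auto
  also have "\<dots> = real (vol G) / (real (vol G) - real (degree G v))"
    unfolding rayleigh_def en disp using deg gap D by (simp add: divide_simps)
  \<comment> \<open>Both denominators are positive; cross-multiplying and cancelling the common
    product of \<open>n\<close> and the volume leaves exactly \<open>le\<close>.\<close>
  also have "\<dots> \<le> real n / (real n - 1)"
    using gap le assms(4) by (simp add: divide_simps algebra_simps)
  finally show ?thesis .
qed

end
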